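(* For each pair of integers $(m,k)\in\{(3,2),(3,3),(4,2)\}$, there exist infinitely many pairs of positive integers $(N,d)$ such that each of $N, N+d, \ldots, N+(m-1)d$ is $k$-full and $\gcd(d,N)=1$.
   Context: For an integer $k\ge 2$, a positive integer $n$ is called $k$-full if every prime $p$ dividing $n$ satisfies $p^k\mid n$. *)

theory Defs
  imports "HOL-Computational_Algebra.Primes"
begin

(* Intended for k >= 2; 1 is k-full for every k, and 0 is excluded. *)
definition k_full :: "nat \<Rightarrow> nat \<Rightarrow> bool" where
  "k_full k n \<longleftrightarrow> n > 0 \<and> (\<forall>p. prime p \<longrightarrow> p dvd n \<longrightarrow> p ^ k dvd n)"

end

(* Three terms a, c, b with a + b = 2c give a point on an elliptic curve a0 x^3 + b0 y^3 = 2 c0 z^3,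
   and four terms give a point on a twist of y^2 = (x^2 - 1)(x^2 - 9). Multiplication by -2, resp. 3,
   multiplies each term by a cube, resp. a square, so it preserves k-fullness, and from a suitable
   initial point it produces arbitrarily large progressions whose terms stay coprime. *)

theory Submission
  imports Defs
begin

section \<open>Closure properties of k-full numbers\<close>

lemma k_full_mult:
  assumes "k_full k a" and "k_full k b"
  shows "k_full k (a * b)"
  unfolding k_full_def
proof (intro conjI allI impI)
  show "a * b > 0" using assms by (simp add: k_full_def)
  fix p assume "prime p" "p dvd a * b"
  then have "p dvd a \<or> p dvd b" by (simp add: prime_dvd_mult_iff)
  then have "p ^ k dvd a \<or> p ^ k dvd b"
    using assms \<open>prime p\<close> unfolding k_full_def by blast
  then show "p ^ k dvd a * b" by auto
qed

lemma k_full_power: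
  assumes "a > 0" and "k \<le> j"
  shows "k_full k (a ^ j)"
  using assms unfolding k_full_def by (auto intro: dvd_power_le dest: prime_dvd_power)

lemma k_full_antimono:
  assumes "k_full k n" and "j \<le> k"
  shows "k_full j n"
  using assms unfolding k_full_def by (blast intro: dvd_trans le_imp_power_dvd)

abbreviation int_full :: "nat \<Rightarrow> int \<Rightarrow> bool" where
  "int_full k x \<equiv> k_full k (nat \<bar>x\<bar>)"

lemma int_full_mult_power:
  assumes "int_full k x" and "y \<noteq> 0"
  shows "int_full k (x * y ^ k)"
proof -
  have "nat \<bar>x * y ^ k\<bar> = nat \<bar>x\<bar> * nat \<bar>y\<bar> ^ k"
    by (simp add: abs_mult power_abs nat_mult_distrib nat_power_eq)
  then show ?thesis
    using assms k_full_mult k_full_power by simp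
qed

lemma int_full_dvd:
  fixes p x :: int
  assumes "int_full k x" and "prime p" and "p dvd x"
  shows "p ^ k dvd x"
proof -
  obtain q where q: "p = int q"
    using prime_ge_0_int[OF assms(2)] nonneg_int_cases by blast
  have "prime q" "q dvd nat \<bar>x\<bar>"
    using assms(2,3) by (simp_all add: q dvd_nat_abs_iff)
  then have "q ^ k dvd nat \<bar>x\<bar>"
    using assms(1) by (auto simp: k_full_def)
  then show ?thesis
    by (simp add: q dvd_nat_abs_iff flip: of_nat_power)
qed

text \<open>\<open>N + 2 * d\<close> is bounded on a finite set. It dominates
  \<open>\<bar>c\<bar>\<close> for triples and \<open>u\<close> for quadruples, the quantities that
  grow under iteration.\<close>

lemma infinite_progressions:
  fixes S :: "(nat \<times> nat) set"
  assumes "\<And>b::nat. \<exists>N d. (N, d) \<in> S \<and> b \<le> N + 2 * d"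
  shows "infinite S"
proof
  assume "finite S"
  then have fin: "finite ((\<lambda>(N, d). N + 2 * d) ` S)" by simp
  obtain N d where "(N, d) \<in> S" and "Suc (Max ((\<lambda>(N, d). N + 2 * d) ` S)) \<le> N + 2 * d"
    using assms by blast
  moreover have "N + 2 * d \<le> Max ((\<lambda>(N, d). N + 2 * d) ` S)"
    using fin \<open>(N, d) \<in> S\<close> by (intro Max_ge) auto
  ultimately show False by simp
qed

subsection \<open>Three terms\<close>

text \<open>\<open>c\<close> is the middle term of a signed progression \<open>a, c, b\<close>:
  intermediate triples may have outer terms of opposite signs.\<close>

definition full_triple :: "int \<Rightarrow> int \<Rightarrow> int \<Rightarrow> bool" where
  "full_triple a b c \<longleftrightarrow> a + b = 2 * c \<and> coprime a b \<and> odd a \<and> 3 dvd b \<and>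
     int_full 3 a \<and> int_full 3 b \<and> int_full 3 c"

lemma full_triple_nonzero:
  assumes "full_triple a b c"
  shows "a \<noteq> 0" and "b \<noteq> 0" and "c \<noteq> 0"
  using assms by (auto simp: full_triple_def k_full_def)

text \<open>\<open>a\<close> and \<open>b\<close> are odd, so the first two factors are odd. Equal
  coprime \<open>a\<close> and \<open>b\<close> would be units, against
  \<open>3 dvd b\<close>.\<close>

lemma full_triple_factors_nonzero:
  assumes "full_triple a b c"
  shows "a + 2 * b \<noteq> 0" and "2 * a + b \<noteq> 0" and "2 \<le> \<bar>a - b\<bar>"
proof -
  have "even (a + b)" and "odd a" and "coprime a b" "3 dvd b"
    using assms by (auto simp: full_triple_def)
  then have *: "odd a" "odd b"
    by simp_all
  show "a + 2 * b \<noteq> 0" "2 * a + b \<noteq> 0"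
    using * by presburger+
  have "a \<noteq> b"
  proof
    assume "a = b"
    then have "\<bar>b\<bar> = 1" using \<open>coprime a b\<close> by simp
    then show False using \<open>3 dvd b\<close> by presburger
  qed
  then show "2 \<le> \<bar>a - b\<bar>"
    using * by presburger
qed

text \<open>The tangent construction on the cubic curve: for \<open>A + B + C = 0\<close> the triple
  \<open>A (B - C)\<^sup>3, B (C - A)\<^sup>3, C (A - B)\<^sup>3\<close> again has sum 0; here \<open>C = - 2 c\<close>. The condition
  \<open>3 dvd b\<close> is what keeps the new triple coprime.\<close>

lemma full_triple_step:
  assumes "full_triple a b c"
  shows "full_triple (a * (a + 2 * b) ^ 3) (- (b * (2 * a + b) ^ 3)) (c * (a - b) ^ 3)"
proof -
  note nz = full_triple_factors_nonzero[OF assms]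
  have sum: "a + b = 2 * c" and cop: "coprime a b" and odd: "odd a" and b3: "3 dvd b"
    and full: "int_full 3 a" "int_full 3 b" "int_full 3 c"
    using assms by (auto simp: full_triple_def)
  have ab: "coprime a (2 * a + b)" "coprime (a + 2 * b) b"
    using cop gcd_add_mult[of a 2 b] gcd_add_mult[of b 2 a]
    by (simp_all add: coprime_iff_gcd_eq_1 gcd.commute add.commute)
  \<comment> \<open>Common divisors of both cofactors divide \<open>3 * b\<close>, and
    \<open>a + 2 * b\<close> is coprime to it because 3 divides \<open>b\<close> but not
    \<open>a\<close>.\<close>
  have "\<not> 3 dvd a"
    using coprime_common_divisor[OF cop _ b3] by auto
  then have "\<not> 3 dvd a + 2 * b"
    using b3 by presburger
  then have "coprime (a + 2 * b) (3 * b)"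
    using ab(2) by (simp add: prime_imp_coprime coprime_commute)
  moreover have "3 * b = 2 * (a + 2 * b) - (2 * a + b)"
    by simp
  ultimately have "coprime (a + 2 * b) (2 * a + b)"
    unfolding coprime_def by (metis dvd_diff dvd_mult)
  then have "coprime (a * (a + 2 * b) ^ 3) (b * (2 * a + b) ^ 3)"
    using cop ab by (simp add: coprime_commute)
  moreover have "a * (a + 2 * b) ^ 3 - b * (2 * a + b) ^ 3 = 2 * (c * (a - b) ^ 3)"
  proof -
    have "a * (a + 2 * b) ^ 3 - b * (2 * a + b) ^ 3 = (a + b) * (a - b) ^ 3"
      by (simp add: power3_eq_cube algebra_simps)
    then show ?thesis by (simp add: sum)
  qed
  moreover have "int_full 3 (a * (a + 2 * b) ^ 3)" "int_full 3 (b * (2 * a + b) ^ 3)"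
    "int_full 3 (c * (a - b) ^ 3)"
    using full nz by (auto intro!: int_full_mult_power)
  moreover have "odd (a * (a + 2 * b) ^ 3)"
    using odd b3 sum by simp
  ultimately show ?thesis
    unfolding full_triple_def
    by (simp only: add_uminus_conv_diff abs_minus_cancel coprime_minus_right_iff dvd_minus_iff
        dvd_mult2[OF b3] simp_thms)
qed

lemma full_triple_step_grows:
  assumes "full_triple a b c"
  shows "\<bar>c\<bar> < \<bar>c * (a - b) ^ 3\<bar>"
proof -
  have "c \<noteq> 0"
    using full_triple_nonzero[OF assms] by simp
  moreover have "2 ^ 3 \<le> \<bar>a - b\<bar> ^ 3"
    using full_triple_factors_nonzero(3)[OF assms] by (intro power_mono) simp_all
  ultimately show ?thesis
    by (simp add: abs_mult power_abs)
qed

text \<open>For \<open>a * b < 0\<close> the new product of outer terms has the sign of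
  \<open>2 * (a + b)\<^sup>2 + a * b\<close>, as the cofactor is its cube.\<close>

lemma full_triple_product:
  fixes a b :: int
  shows "(a * (a + 2 * b) ^ 3) * (- (b * (2 * a + b) ^ 3)) = - (a * b) * (2 * (a + b)\<^sup>2 + a * b) ^ 3"
proof -
  have "(a + 2 * b) * (2 * a + b) = 2 * (a + b)\<^sup>2 + a * b"
    by (simp add: power2_eq_square algebra_simps)
  then show ?thesis
    by (simp flip: power_mult_distrib)
qed

text \<open>When the signs differ, the bound makes the base of the cube in
  \<open>full_triple_product\<close> nonnegative and parity makes it nonzero, so one step
  suffices.\<close>

lemma full_triple_small:
  assumes "full_triple a b c" and "- (a * b) \<le> 8 * c\<^sup>2"
  shows "\<exists>a' b' c'. full_triple a' b' c' \<and> a' * b' > 0 \<and> \<bar>c\<bar> \<le> \<bar>c'\<bar>"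
proof (cases "a * b > 0")
  case True
  then show ?thesis using assms by blast
next
  case False
  have ab: "a + b = 2 * c" "odd a" "a \<noteq> 0" "b \<noteq> 0"
    using assms by (auto simp: full_triple_def k_full_def)
  then have "odd b" by presburger
  have "2 * (a + b)\<^sup>2 = 8 * c\<^sup>2"
    using ab by (simp add: power2_eq_square)
  moreover have "- (a * b) \<noteq> 8 * c\<^sup>2"
  proof
    assume "- (a * b) = 8 * c\<^sup>2"
    then have "even (- (a * b))" by simp
    then show False using \<open>odd a\<close> \<open>odd b\<close> by simp
  qed
  ultimately have "2 * (a + b)\<^sup>2 + a * b > 0"
    using assms(2) by linarith
  moreover have "a * b < 0"
    using False ab by (simp add: not_less order_less_le)
  ultimately have "(a * (a + 2 * b) ^ 3) * (- (b * (2 * a + b) ^ 3)) > 0"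
    unfolding full_triple_product by (simp add: mult_neg_pos)
  then show ?thesis
    using full_triple_step[OF assms(1)] full_triple_step_grows[OF assms(1)] by fastforce
qed

text \<open>Put \<open>w = 8 * c\<^sup>2 / - (a * b)\<close>. If \<open>a\<close> and \<open>b\<close> have opposite signs and \<open>w > 1\<close>, the
  step makes the signs equal; if \<open>w < 1\<close>, it multiplies \<open>w\<close> by at least 64.\<close>

lemma full_triple_same_sign_aux:
  assumes "full_triple a b c" and "- (a * b) \<le> 64 ^ n * (8 * c\<^sup>2)"
  shows "\<exists>a' b' c'. full_triple a' b' c' \<and> a' * b' > 0 \<and> \<bar>c\<bar> \<le> \<bar>c'\<bar>"
  using assms
proof (induction n arbitrary: a b c)
  case (0 a b c)
  then show ?case
    using full_triple_small[of a b c] by simp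
next
  case (Suc n a b c)
  \<comment> \<open>The step sends \<open>p\<close> to \<open>p * (p - 2 * s) ^ 3\<close> and
    \<open>s\<close> to \<open>s * (s + 4 * p) ^ 3\<close>. While \<open>p > 2 * s\<close>, this
    divides \<open>p / s\<close> by at least \<open>4 ^ 3\<close>.\<close>
  define s p where "s = 4 * c\<^sup>2" and "p = - (a * b)"
  have s: "s = (a + b)\<^sup>2"
    using Suc.prems(1) by (simp add: s_def full_triple_def power2_eq_square)
  show ?case
  proof (cases "p \<le> 2 * s")
    case True
    then show ?thesis
      using full_triple_small[OF Suc.prems(1)] by (simp add: s_def p_def)
  next
    case False
    have "s \<ge> 0" by (simp add: s_def)
    have "p - 2 * s = - (2 * (a + b)\<^sup>2 + a * b)"
      by (simp add: s p_def)
    then have "(p - 2 * s) ^ 3 = - ((2 * (a + b)\<^sup>2 + a * b) ^ 3)"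
      by (simp only: power_minus_odd[OF odd_numeral])
    then have "- (a * (a + 2 * b) ^ 3 * (- (b * (2 * a + b) ^ 3))) = p * (p - 2 * s) ^ 3"
      unfolding full_triple_product p_def by simp
    also have "\<dots> \<le> 64 ^ Suc n * (2 * s) * (p - 2 * s) ^ 3"
      using Suc.prems(2) False by (intro mult_right_mono) (simp_all add: s_def p_def)
    also have "\<dots> = 64 ^ n * (2 * s) * (4 * (p - 2 * s)) ^ 3"
      unfolding power_mult_distrib by simp
    also have "\<dots> \<le> 64 ^ n * (2 * s) * (s + 4 * p) ^ 3"
      using False \<open>s \<ge> 0\<close> by (intro mult_left_mono power_mono) simp_all
    also have "s + 4 * p = (a - b)\<^sup>2"
      by (simp add: s p_def power2_eq_square algebra_simps)
    also have "64 ^ n * (2 * s) * ((a - b)\<^sup>2) ^ 3 = 64 ^ n * (8 * (c * (a - b) ^ 3)\<^sup>2)"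
      by (simp add: s_def power_mult_distrib flip: power_mult)
    finally obtain a' b' c' where "full_triple a' b' c'" "a' * b' > 0"
        "\<bar>c * (a - b) ^ 3\<bar> \<le> \<bar>c'\<bar>"
      using Suc.IH[OF full_triple_step[OF Suc.prems(1)]] by blast
    then show ?thesis
      using full_triple_step_grows[OF Suc.prems(1)] by fastforce
  qed
qed

lemma full_triple_same_sign:
  assumes "full_triple a b c"
  shows "\<exists>a' b' c'. full_triple a' b' c' \<and> a' * b' > 0 \<and> \<bar>c\<bar> \<le> \<bar>c'\<bar>"
proof (rule full_triple_same_sign_aux[OF assms])
  have "c \<noteq> 0"
    using full_triple_nonzero[OF assms] by simp
  then have "1 \<le> c\<^sup>2"
    by (simp add: int_one_le_iff_zero_less)
  let ?n = "nat \<bar>a * b\<bar>"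
  have "?n < 64 ^ ?n"
    by (rule power_gt_expt) simp
  then have "int ?n < 64 ^ ?n"
    by (metis of_nat_less_iff of_nat_numeral of_nat_power)
  then have "- (a * b) \<le> 64 ^ ?n"
    by linarith
  also have "64 ^ ?n \<le> 64 ^ ?n * (8 * c\<^sup>2)"
    using \<open>1 \<le> c\<^sup>2\<close> by simp
  finally show "- (a * b) \<le> 64 ^ ?n * (8 * c\<^sup>2)" .
qed

lemma full_triple_unbounded: "\<exists>a b c. full_triple a b c \<and> int n \<le> \<bar>c\<bar>"
proof (induction n)
  case 0
  \<comment> \<open>The seed is \<open>11 ^ 3 - 3 ^ 4 = 2 * 5 ^ 4\<close>; its outer terms still
    differ in sign.\<close>
  have "k_full 3 (11 ^ 3)" "k_full 3 (3 ^ 4)" "k_full 3 (5 ^ 4)"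
    by (rule k_full_power; simp)+
  then have "full_triple 1331 (- 81) 625"
    by (simp add: full_triple_def coprime_iff_gcd_eq_1 gcd_int_def gcd_non_0_nat)
  then show ?case by fastforce
next
  case (Suc n)
  then obtain a b c where "full_triple a b c" "int n \<le> \<bar>c\<bar>" by blast
  then have "int (Suc n) \<le> \<bar>c * (a - b) ^ 3\<bar>"
    using full_triple_step_grows[of a b c] by linarith
  then show ?case
    using full_triple_step[OF \<open>full_triple a b c\<close>] by blast
qed

lemma infinite_full_3_terms:
  "infinite {(N, d). N > 0 \<and> d > 0 \<and> (\<forall>i<3. k_full 3 (N + i * d)) \<and> gcd d N = 1}"
    (is "infinite ?S")
proof (rule infinite_progressions)
  fix n
  obtain a b c where t: "full_triple a b c" "a * b > 0" "int n \<le> \<bar>c\<bar>"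
    using full_triple_unbounded[of n] full_triple_same_sign by (meson order_trans)
  then have abc: "a + b = 2 * c" "coprime a b"
      "int_full 3 a" "int_full 3 b" "int_full 3 c"
    by (simp_all add: full_triple_def)
  note nz = full_triple_nonzero(1,2)[OF t(1)]
  have "a \<noteq> b"
    using full_triple_factors_nonzero(3)[OF t(1)] by linarith
  define x y z where "x = nat \<bar>a\<bar>" and "y = nat \<bar>b\<bar>" and "z = nat \<bar>c\<bar>"
  \<comment> \<open>Equal signs carry the sum over to absolute values, making \<open>z\<close> the
    midpoint of \<open>x\<close> and \<open>y\<close>.\<close>
  have "\<bar>a\<bar> + \<bar>b\<bar> = 2 * \<bar>c\<bar>" "\<bar>a\<bar> \<noteq> \<bar>b\<bar>"
    using abc(1) \<open>a \<noteq> b\<close> \<open>a * b > 0\<close> by (auto simp: zero_less_mult_iff)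
  then have "int (x + y) = int (2 * z)" "int x \<noteq> int y" "x > 0" "y > 0"
    using nz by (simp_all add: x_def y_def z_def)
  then have xyz: "x + y = 2 * z" "x \<noteq> y" "x > 0" "y > 0"
    by (simp_all only: of_nat_eq_iff not_False_eq_True)
  define N d where "N = min x y" and "d = z - min x y"
  have pos: "N > 0" "d > 0" and z: "N + d = z"
    and xy: "N = x \<and> N + 2 * d = y \<or> N = y \<and> N + 2 * d = x"
    using xyz by (cases "x \<le> y"; force simp: N_def d_def)+
  have full: "k_full 3 x" "k_full 3 y" "k_full 3 z"
    using abc(3-5) by (simp_all add: x_def y_def z_def)
  have "k_full 3 (N + i * d)" if "i < 3" for i
  proof -
    have "i \<in> {0, 1, 2}" using that by auto
    then show ?thesis using full xy z by auto
  qed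
  moreover have "coprime N (N + 2 * d)"
    using xy abc(2) by (auto simp: x_def y_def coprime_commute)
  then have "coprime N (2 * d)"
    using gcd_add_mult[of N 1 "2 * d"] by (simp add: coprime_iff_gcd_eq_1)
  then have "gcd d N = 1"
    by (simp add: coprime_commute)
  ultimately have "(N, d) \<in> ?S"
    using pos by simp
  moreover have "n \<le> N + 2 * d"
    using z \<open>int n \<le> \<bar>c\<bar>\<close> unfolding z_def by linarith
  ultimately show "\<exists>N d. (N, d) \<in> ?S \<and> n \<le> N + 2 * d"
    by (intro exI conjI)
qed

subsection \<open>Four terms\<close>

text \<open>The terms are centred at \<open>u\<close>; their product over \<open>e ^ 4\<close> is
  \<open>(x\<^sup>2 - 1) * (x\<^sup>2 - 9)\<close> at \<open>x = u / e\<close>. A negative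
  \<open>e\<close> is allowed.\<close>

definition full_quadruple :: "int \<Rightarrow> int \<Rightarrow> bool" where
  "full_quadruple u e \<longleftrightarrow> coprime u e \<and> odd (u + e) \<and> e \<noteq> 0 \<and> 3 * \<bar>e\<bar> < u \<and>
     int_full 2 (u - 3 * e) \<and> int_full 2 (u - e) \<and> int_full 2 (u + e) \<and> int_full 2 (u + 3 * e)"

text \<open>The map \<open>u / e \<mapsto> (u * P u e) / (e * Q u e)\<close> is the multiplication by 3 on the
  elliptic curve \<open>y\<^sup>2 = (x\<^sup>2 - 1) * (x\<^sup>2 - 9)\<close>, read on the \<open>x\<close>-coordinate.
  It fixes the 2-torsion points \<open>x = \<plusminus> 1, \<plusminus> 3\<close>, hence the square cofactors below.\<close>

definition P :: "int \<Rightarrow> int \<Rightarrow> int" where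
  "P u e = u ^ 8 - 54 * u ^ 4 * e ^ 4 + 360 * u ^ 2 * e ^ 6 - 243 * e ^ 8"

definition Q :: "int \<Rightarrow> int \<Rightarrow> int" where
  "Q u e = - 3 * u ^ 8 + 40 * u ^ 6 * e ^ 2 - 54 * u ^ 4 * e ^ 4 + 81 * e ^ 8"

lemma tripling_factors:
  "u * P u e - 3 * (e * Q u e) = (u - 3 * e) * (u ^ 4 + 6 * u ^ 3 * e - 6 * u * e ^ 3 - 9 * e ^ 4)\<^sup>2"
  "u * P u e - e * Q u e = (u - e) * (u ^ 4 + 2 * u ^ 3 * e - 18 * u * e ^ 3 - 9 * e ^ 4)\<^sup>2"
  "u * P u e + e * Q u e = (u + e) * (u ^ 4 - 2 * u ^ 3 * e + 18 * u * e ^ 3 - 9 * e ^ 4)\<^sup>2"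
  "u * P u e + 3 * (e * Q u e) = (u + 3 * e) * (u ^ 4 - 6 * u ^ 3 * e + 6 * u * e ^ 3 - 9 * e ^ 4)\<^sup>2"
  unfolding P_def Q_def by algebra+

lemma even_P_iff: "even (P u e) \<longleftrightarrow> even (u + e)"
  and even_Q_iff: "even (Q u e) \<longleftrightarrow> even (u + e)"
  by (simp_all add: P_def Q_def)

text \<open>A Bezout identity for \<open>P\<close> and \<open>Q\<close> as polynomials in
  \<open>u\<close>: a prime dividing both values divides 2, 3 or \<open>e\<close>.\<close>

lemma resultant_P_Q:
  "(120 * u ^ 6 - 1519 * u ^ 4 * e ^ 2 + 1080 * u ^ 2 * e ^ 4 + 1215 * e ^ 6) * P u e +
   (40 * u ^ 6 + 27 * u ^ 4 * e ^ 2 - 2160 * u ^ 2 * e ^ 4 + 12861 * e ^ 6) * Q u e =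
   2 ^ 10 * 3 ^ 6 * e ^ 14"
  unfolding P_def Q_def by algebra

text \<open>Makes the centre at least double under tripling. From
  \<open>81 * e ^ 4 \<le> u ^ 4\<close> come \<open>u ^ 4 \<ge> 81\<close> and
  \<open>u ^ 4 - 54 * e ^ 4 \<ge> 27\<close>.\<close>

lemma P_ge_2:
  assumes "e \<noteq> 0" and "3 * \<bar>e\<bar> < u"
  shows "2 \<le> P u e"
proof -
  have "3 * \<bar>e\<bar> \<le> \<bar>u\<bar>" using assms by simp
  then have "(3 * \<bar>e\<bar>) ^ 4 \<le> \<bar>u\<bar> ^ 4" "(3 * \<bar>e\<bar>) ^ 2 \<le> \<bar>u\<bar> ^ 2"
    by (intro power_mono; simp)+
  then have *: "81 * e ^ 4 \<le> u ^ 4" "9 * e ^ 2 \<le> u ^ 2"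
    by (simp_all add: power_mult_distrib)
  have "e ^ 4 \<ge> 1"
    using \<open>e \<noteq> 0\<close> by (simp add: int_one_le_iff_zero_less)
  have "2 \<le> 81 * (27 :: int)"
    by simp
  also have "\<dots> \<le> u ^ 4 * (u ^ 4 - 54 * e ^ 4)"
    using * \<open>e ^ 4 \<ge> 1\<close> by (intro mult_mono) linarith+
  also have "0 \<le> e ^ 6 * (360 * u ^ 2 - 243 * e ^ 2)"
    using *(2) zero_le_power2[of e] by (intro mult_nonneg_nonneg) (simp, linarith)
  then have "u ^ 4 * (u ^ 4 - 54 * e ^ 4) \<le> u ^ 4 * (u ^ 4 - 54 * e ^ 4) + e ^ 6 * (360 * u ^ 2 - 243 * e ^ 2)"
    by simp
  also have "\<dots> = P u e"
    unfolding P_def by algebra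
  finally show ?thesis .
qed

text \<open>If 3 divided \<open>u\<close>, it would divide both outer terms; by fullness 9 would
  divide them and their difference \<open>6 * e\<close>, so 3 would also divide
  \<open>e\<close>.\<close>

lemma full_quadruple_not_dvd_3:
  assumes "full_quadruple u e"
  shows "\<not> 3 dvd u"
proof
  have "prime (3 :: int)" by simp
  assume "3 dvd u"
  then have "3 dvd u - 3 * e" "3 dvd u + 3 * e"
    by simp_all
  moreover have "int_full 2 (u - 3 * e)" "int_full 2 (u + 3 * e)"
    using assms by (simp_all add: full_quadruple_def)
  ultimately have "3\<^sup>2 dvd u - 3 * e" "3\<^sup>2 dvd u + 3 * e"
    using int_full_dvd[of 2 "u - 3 * e" 3] int_full_dvd[of 2 "u + 3 * e" 3] \<open>prime (3 :: int)\<close>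
    by blast+
  then have "3\<^sup>2 dvd (u + 3 * e) - (u - 3 * e)"
    by (rule dvd_diff[rotated])
  then have "3 dvd e"
    by (simp only: power2_eq_square) presburger
  then show False
    using assms \<open>3 dvd u\<close> coprime_common_divisor[of u e 3] by (simp add: full_quadruple_def)
qed

text \<open>A common prime is not 2 by parity, nor 3 since \<open>u * P u e\<close> is
  \<open>u ^ 9\<close> modulo 3. It does not divide \<open>e\<close> by the term
  \<open>u ^ 8\<close> of \<open>P\<close>, nor \<open>u\<close> by the term
  \<open>81 * e ^ 8\<close> of \<open>Q\<close>; so it divides \<open>P\<close> and
  \<open>Q\<close>, against \<open>resultant_P_Q\<close>.\<close>

lemma coprime_tripling:
  assumes "coprime u e" and "odd (u + e)" and "\<not> 3 dvd u"
  shows "coprime (u * P u e) (e * Q u e)"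
proof (rule ccontr)
  have odd: "odd (u * P u e + e * Q u e)"
    using assms(2) by (simp add: even_P_iff even_Q_iff)
  assume "\<not> coprime (u * P u e) (e * Q u e)"
  then obtain r where r: "r dvd u * P u e" "r dvd e * Q u e" "\<not> is_unit r"
    by (rule not_coprimeE)
  moreover have "r \<noteq> 0"
    using r(1,2) odd by force
  ultimately obtain p where p: "prime p" "p dvd u * P u e" "p dvd e * Q u e"
    using prime_divisor_exists[of r] by (meson dvd_trans)
  have dvd_power: "p dvd x" if "p dvd x ^ n" for x n
    using \<open>prime p\<close> that by (rule prime_dvd_power)
  have "\<not> p dvd 2"
  proof
    assume "p dvd 2"
    then have "p = 2" using \<open>prime p\<close> by (simp add: primes_dvd_imp_eq)
    then show False using odd p(2,3) by (simp del: even_mult_iff)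
  qed
  have "\<not> p dvd 3"
  proof
    assume "p dvd 3"
    then have "p = 3" using \<open>prime p\<close> by (simp add: primes_dvd_imp_eq)
    moreover have "u ^ 9 = u * P u e + 3 * (u * (18 * u ^ 4 * e ^ 4 - 120 * u ^ 2 * e ^ 6 + 81 * e ^ 8))"
      unfolding P_def by algebra
    ultimately have "p dvd u ^ 9"
      using p(2) by (metis dvd_add dvd_triv_left)
    then show False using assms(3) \<open>p = 3\<close> dvd_power by blast
  qed
  have "\<not> p dvd u \<or> \<not> p dvd e"
    using assms(1) \<open>prime p\<close> by (meson coprime_common_divisor not_prime_unit)
  have "\<not> p dvd e"
  proof
    assume "p dvd e"
    then have "p dvd P u e"
      using p \<open>\<not> p dvd u \<or> \<not> p dvd e\<close> by (simp add: prime_dvd_mult_iff)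
    moreover have "u ^ 8 = P u e + e * (54 * u ^ 4 * e ^ 3 - 360 * u ^ 2 * e ^ 5 + 243 * e ^ 7)"
      unfolding P_def by algebra
    ultimately have "p dvd u ^ 8"
      using \<open>p dvd e\<close> by simp
    then show False
      using \<open>p dvd e\<close> \<open>\<not> p dvd u \<or> \<not> p dvd e\<close> dvd_power by blast
  qed
  then have "p dvd Q u e"
    using p by (simp add: prime_dvd_mult_iff)
  have "\<not> p dvd u"
  proof
    assume "p dvd u"
    moreover have "3 ^ 4 * e ^ 8 = Q u e + u * (3 * u ^ 7 - 40 * u ^ 5 * e ^ 2 + 54 * u ^ 3 * e ^ 4)"
      unfolding Q_def by algebra
    ultimately have "p dvd 3 ^ 4 * e ^ 8"
      using \<open>p dvd Q u e\<close> by (metis dvd_add dvd_mult2)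
    then show False
      using \<open>prime p\<close> \<open>\<not> p dvd 3\<close> \<open>\<not> p dvd e\<close> dvd_power by (meson prime_dvd_multD)
  qed
  then have "p dvd P u e"
    using p by (simp add: prime_dvd_mult_iff)
  then have "p dvd 2 ^ 10 * 3 ^ 6 * e ^ 14"
    using \<open>p dvd Q u e\<close> by (subst resultant_P_Q[symmetric, of e u]) (intro dvd_add dvd_mult)
  then show False
    using \<open>prime p\<close> \<open>\<not> p dvd 2\<close> \<open>\<not> p dvd 3\<close> \<open>\<not> p dvd e\<close> dvd_power by (meson prime_dvd_multD)
qed

lemma full_quadruple_step:
  assumes "full_quadruple u e"
  shows "full_quadruple (u * P u e) (e * Q u e)"
proof -
  have odd: "odd (u + e)" and full: "int_full 2 (u - 3 * e)" "int_full 2 (u - e)"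
      "int_full 2 (u + e)" "int_full 2 (u + 3 * e)"
    and "e \<noteq> 0" "3 * \<bar>e\<bar> < u"
    using assms by (simp_all add: full_quadruple_def)
  have odd_nonzero: "z \<noteq> 0" if "odd z" for z :: int
    using that by auto
  \<comment> \<open>Modulo 2 each quartic is congruent to \<open>u + e\<close>, hence odd.\<close>
  have nz: "u ^ 4 + 6 * u ^ 3 * e - 6 * u * e ^ 3 - 9 * e ^ 4 \<noteq> 0"
    "u ^ 4 + 2 * u ^ 3 * e - 18 * u * e ^ 3 - 9 * e ^ 4 \<noteq> 0"
    "u ^ 4 - 2 * u ^ 3 * e + 18 * u * e ^ 3 - 9 * e ^ 4 \<noteq> 0"
    "u ^ 4 - 6 * u ^ 3 * e + 6 * u * e ^ 3 - 9 * e ^ 4 \<noteq> 0"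
    using odd by (intro odd_nonzero; simp)+
  have "Q u e \<noteq> 0"
    using odd even_Q_iff[of u e] by auto
  moreover have "coprime (u * P u e) (e * Q u e)"
    using assms full_quadruple_not_dvd_3 by (intro coprime_tripling) (simp_all add: full_quadruple_def)
  moreover have "odd (u * P u e + e * Q u e)"
    using odd by (simp add: even_P_iff even_Q_iff)
  moreover have "u * P u e - 3 * (e * Q u e) > 0" "u * P u e + 3 * (e * Q u e) > 0"
    unfolding tripling_factors using \<open>3 * \<bar>e\<bar> < u\<close> nz by (auto intro!: mult_pos_pos)
  then have "3 * \<bar>e * Q u e\<bar> < u * P u e"
    by linarith
  moreover have "int_full 2 (u * P u e - 3 * (e * Q u e))" "int_full 2 (u * P u e - e * Q u e)"
    "int_full 2 (u * P u e + e * Q u e)" "int_full 2 (u * P u e + 3 * (e * Q u e))"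
    unfolding tripling_factors using full nz by (blast intro: int_full_mult_power)+
  ultimately show ?thesis
    using \<open>e \<noteq> 0\<close> unfolding full_quadruple_def by simp
qed

text \<open>An explicit Bezout certificate settles coprimality of the large seed by
  evaluation.\<close>

lemma coprime_if_bezout:
  fixes a b :: int
  assumes "x * a - y * b = 1"
  shows "coprime a b"
proof (rule coprimeI)
  fix r assume "r dvd a" "r dvd b"
  then have "r dvd x * a - y * b" by simp
  then show "is_unit r" unfolding assms .
qed

text \<open>The initial progression has the shape \<open>x\<^sup>2, 3\<^sup>3 y\<^sup>2, 5\<^sup>3 z\<^sup>2, 7\<^sup>3 w\<^sup>2\<close>. It comes from combining
  known points on the twist of the curve by 105, among them that of \<open>1, 3, 5, 7\<close>, until the point
  satisfies the congruences modulo 3, 5 and 7.\<close>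

lemma full_quadruple_unbounded: "\<exists>u e. full_quadruple u e \<and> int n \<le> u"
proof (induction n)
  case 0
  let ?u = "67894945441160041988610728677150128442872644084624517738484063552701416143767304134595404308241994498734616421970140651404 :: int"
  let ?e = "13667060466266633515042680203654999271157978050168171382333838895133558085885841028445255174895530663220202192524599793721 :: int"
  \<comment> \<open>In order, these are \<open>?u - 3 * ?e\<close>, \<open>?u - ?e\<close>,
    \<open>?u + ?e\<close>, \<open>?u + 3 * ?e\<close>.\<close>
  have "k_full 2 (5185919787497695325636839379542872501437358712535616235289329 ^ 2)"
    "k_full 2 (3 ^ 3 * 1417194476511714120132201749259049459187838812001642850732723 ^ 2)"
    "k_full 2 (5 ^ 3 * 807772274381470339921389559111495652135146623641494446602669 ^ 2)"
    "k_full 2 (7 ^ 3 * 563454895584805259463102065891550887345872820229660461709713 ^ 2)"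
    by (intro k_full_mult k_full_power; simp)+
  moreover have "3172754290537678593821561603289492195314543606975702339276469079380016811746585939331892060419147457522674914713966807849 * ?u -
      15761544333981112908326323083829747260167036135792044877403226714967007048446113675634572643887753230429590685572526886595 * ?e = 1"
    by simp
  then have "coprime ?u ?e"
    by (rule coprime_if_bezout)
  ultimately have "full_quadruple ?u ?e"
    by (simp add: full_quadruple_def)
  then show ?case
    by (intro exI[of _ ?u] exI[of _ ?e]) simp
next
  case (Suc n)
  then obtain u e where ue: "full_quadruple u e" "int n \<le> u" by blast
  then have "0 < u" "2 \<le> P u e"
    using P_ge_2 by (auto simp: full_quadruple_def)
  then have "u * 2 \<le> u * P u e"
    by (intro mult_left_mono) simp_all
  then have "int (Suc n) \<le> u * P u e"
    using ue(2) \<open>0 < u\<close> by linarith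
  then show ?case
    using full_quadruple_step[OF ue(1)] by blast
qed

lemma infinite_full_4_terms:
  "infinite {(N, d). N > 0 \<and> d > 0 \<and> (\<forall>i<4. k_full 2 (N + i * d)) \<and> gcd d N = 1}"
    (is "infinite ?S")
proof (rule infinite_progressions)
  fix n
  obtain u e where ue: "full_quadruple u e" "int n \<le> u"
    using full_quadruple_unbounded by blast
  define v f where "v = nat u" and "f = nat \<bar>e\<bar>"
  have vf: "3 * f < v" "f > 0"
    using ue(1) unfolding v_def f_def by (auto simp: full_quadruple_def)
  have u: "u = int v" and e: "\<bar>e\<bar> = int f"
    using vf by (simp_all add: v_def f_def)
  define N d where "N = v - 3 * f" and "d = 2 * f"
  \<comment> \<open>Replacing \<open>e\<close> by \<open>\<bar>e\<bar>\<close> at most reverses the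
    progression.\<close>
  have "int_full 2 (u - 3 * \<bar>e\<bar>)" "int_full 2 (u - \<bar>e\<bar>)" "int_full 2 (u + \<bar>e\<bar>)" "int_full 2 (u + 3 * \<bar>e\<bar>)"
    using ue(1) by (auto simp: full_quadruple_def abs_if)
  moreover have "u - 3 * \<bar>e\<bar> = int (N + 0 * d)" "u - \<bar>e\<bar> = int (N + 1 * d)"
      "u + \<bar>e\<bar> = int (N + 2 * d)" "u + 3 * \<bar>e\<bar> = int (N + 3 * d)"
    using vf unfolding u e N_def d_def by (simp_all add: of_nat_diff)
  ultimately have terms: "k_full 2 (N + 0 * d)" "k_full 2 (N + 1 * d)"
      "k_full 2 (N + 2 * d)" "k_full 2 (N + 3 * d)"
    by (simp_all only: abs_of_nat nat_int)
  have "k_full 2 (N + i * d)" if "i < 4" for i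
  proof -
    have "i = 0 \<or> i = 1 \<or> i = 2 \<or> i = 3" using that by linarith
    then show ?thesis using terms by blast
  qed
  \<comment> \<open>As \<open>d = 2 * f\<close>, coprimality of \<open>d\<close> and
    \<open>N\<close> splits into this and the oddness of \<open>N\<close>.\<close>
  moreover have "coprime f N"
  proof -
    have "coprime e u" using ue(1) by (simp add: full_quadruple_def coprime_commute)
    then have "coprime f v" by (simp add: u f_def)
    moreover have "v = 3 * f + N" using vf by (simp add: N_def)
    ultimately show ?thesis by (simp add: coprime_iff_gcd_eq_1 gcd_add_mult)
  qed
  moreover have "odd N"
  proof -
    have "odd (u + \<bar>e\<bar>)" using ue(1) by (auto simp: full_quadruple_def)
    then have "odd (v + f)" unfolding u e by presburger
    then show ?thesis using vf by (simp add: N_def)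
  qed
  ultimately have "(N, d) \<in> ?S"
    using vf by (simp add: N_def d_def)
  moreover have "n \<le> N + 2 * d"
    using vf ue(2) unfolding u N_def d_def by linarith
  ultimately show "\<exists>N d. (N, d) \<in> ?S \<and> n \<le> N + 2 * d"
    by (intro exI conjI)
qed

theorem theorem2:
  fixes m k :: nat
  assumes "(m, k) \<in> {(3, 2), (3, 3), (4, 2)}"
  shows "infinite {(N, d). N > 0 \<and> d > 0 \<and> (\<forall>i<m. k_full k (N + i * d)) \<and> gcd d N = 1}"
proof -
  \<comment> \<open>The case (3, 2) follows from (3, 3), since 3-full numbers are 2-full.\<close>
  have "infinite {(N, d). N > 0 \<and> d > 0 \<and> (\<forall>i<3. k_full 2 (N + i * d)) \<and> gcd d N = 1}"
    by (rule infinite_super[OF _ infinite_full_3_terms]) (auto intro: k_full_antimono)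
  then show ?thesis
    using assms infinite_full_3_terms infinite_full_4_terms by auto
qed

end
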